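(* Let $\mathbf{O}$ be an appropriate class of operators. Suppose there exist an $\mathbf{O}$-representable function $C:\mathbb{N}^2\to\mathbb{N}$ and $\mathbf{O}$-representable functions $L,R:\mathbb{N}\to\mathbb{N}$ such that $$\{(u,v)\in\mathbb{N}^2\mid C(u,v)=0\}=\{(0,0)\},\qquad \{(L(s),R(s))\mid s\in\mathbb{N}\}=\mathbb{N}^2.$$ Then the substitution operation on real functions preserves conditional $\mathbf{O}$-computability: whenever $\theta_0:D_0\to\mathbb{R}$ with $D_0\subseteq\mathbb{R}^K$ and $\theta_1,\ldots,\theta_K:D_i\to\mathbb{R}$ with $D_i\subseteq\mathbb{R}^N$ are conditionally $\mathbf{O}$-computable, the function $\theta$ defined by $\theta(\bar\xi)=\theta_0(\theta_1(\bar\xi),\ldots,\theta_K(\bar\xi))$ (on the set of all $\bar\xi\in D_1\cap\cdots\cap D_K$ with $(\theta_1(\bar\xi),\ldots,\theta_K(\bar\xi))\in D_0$) is conditionally $\mathbf{O}$-computable.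
   Context: For $m\in\mathbb{N}$, $\mathbb{T}_m$ is the set of all total functions $\mathbb{N}^m\to\mathbb{N}$. For $k\in\mathbb{N}$, a $k$-ary operator is a mapping $\mathbb{T}_1^k\to\mathbb{T}_1$. For $c\in\mathbb{N}$, $\check{c}\in\mathbb{T}_1$ is the constant function with value $c$. A class $\mathbf{O}$ of operators is appropriate if: (1) for all $k$ and $i\in\{1,\ldots,k\}$ the $k$-ary operator $(f_1,\ldots,f_k)\mapsto f_i$ is in $\mathbf{O}$; (2) the binary operator $F(f_1,f_2)(n)=f_1(f_2(n))$ is in $\mathbf{O}$; (3) for all $k,l$, if $F$ is a $k$-ary operator in $\mathbf{O}$ and $G_1,\ldots,G_k$ are $l$-ary operators in $\mathbf{O}$, then $H(g_1,\ldots,g_l)=F(G_1(g_1,\ldots,g_l),\ldots,G_k(g_1,\ldots,g_l))$ is in $\mathbf{O}$; (4) for all $k$, if $F$ is a $(k+1)$-ary operator in $\mathbf{O}$, then $G(f_1,\ldots,f_k)(n)=F(f_1,\ldots,f_k,\check{n})(n)$ is in $\mathbf{O}$. For $f:\mathbb{N}^k\to\mathbb{N}$, $\mathring{f}$ is the $k$-ary operator $\mathring{f}(f_1,\ldots,f_k)(n)=f(f_1(n),\ldots,f_k(n))$, and $f$ is $\mathbf{O}$-representable if $\mathring{f}\in\mathbf{O}$. A triple $(f,g,h)\in\mathbb{T}_1^3$ names $\xi\in\mathbb{R}$ if $\left|\frac{f(t)-g(t)}{h(t)+1}-\xi\right|<\frac{1}{t+1}$ for all $t\in\mathbb{N}$.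 A function $\theta:D\to\mathbb{R}$, $D\subseteq\mathbb{R}^N$, is conditionally $\mathbf{O}$-computable if there exist a $3N$-ary operator $E$ and $(3N+1)$-ary operators $F,G,H$, all in $\mathbf{O}$, such that whenever $(\xi_1,\ldots,\xi_N)\in D$ and $(f_j,g_j,h_j)$ names $\xi_j$ for $j=1,\ldots,N$: (a) there is $s\in\mathbb{N}$ with $E(f_1,g_1,h_1,\ldots,f_N,g_N,h_N)(s)=0$; (b) for every such $s$, the triple $(F(\bar f,\check{s}),G(\bar f,\check{s}),H(\bar f,\check{s}))$, where $\bar f=(f_1,g_1,h_1,\ldots,f_N,g_N,h_N)$, names $\theta(\xi_1,\ldots,\xi_N)$. *)

theory Defs
  imports Complex_Main "HOL-Library.FuncSet"
begin

abbreviation tuples :: "nat \<Rightarrow> 'a list set" where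
  "tuples k \<equiv> {xs. length xs = k}"

type_synonym operator = "(nat \<Rightarrow> nat) list \<Rightarrow> (nat \<Rightarrow> nat)"

text \<open>
  Argument tuples are lists, so a \<open>k\<close>-ary operator is determined by its values on lists of
  length \<open>k\<close>; the extensional function space makes equality of terms agree with equality
  of operators. A class of operators is a family \<open>\<O>\<close>, where \<open>\<O> k\<close> is the set of
  its \<open>k\<close>-ary members. List positions are counted from \<open>0\<close>.
\<close>

definition operators :: "nat \<Rightarrow> operator set" where
  "operators k = tuples k \<rightarrow>\<^sub>E UNIV"

definition const_fun :: "nat \<Rightarrow> (nat \<Rightarrow> nat)" where
  "const_fun c = (\<lambda>_. c)"

definition appropriate :: "(nat \<Rightarrow> operator set) \<Rightarrow> bool" where
  "appropriate \<O> \<longleftrightarrow>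
     (\<forall>k. \<O> k \<subseteq> operators k) \<and>
     (\<forall>k. \<forall>i<k. (\<lambda>fs\<in>tuples k. fs ! i) \<in> \<O> k) \<and>
     (\<lambda>fs\<in>tuples 2. \<lambda>n. (fs ! 0) ((fs ! 1) n)) \<in> \<O> 2 \<and>
     (\<forall>k l. \<forall>F\<in>\<O> k. \<forall>Gs\<in>tuples k. set Gs \<subseteq> \<O> l \<longrightarrow>
        (\<lambda>gs\<in>tuples l. F (map (\<lambda>G. G gs) Gs)) \<in> \<O> l) \<and>
     (\<forall>k. \<forall>F\<in>\<O> (k + 1).
        (\<lambda>fs\<in>tuples k. \<lambda>n. F (fs @ [const_fun n]) n) \<in> \<O> k)"

definition pointwise_operator :: "nat \<Rightarrow> (nat list \<Rightarrow> nat) \<Rightarrow> operator" where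
  "pointwise_operator k f = (\<lambda>fs\<in>tuples k. \<lambda>n. f (map (\<lambda>g. g n) fs))"

definition representable ::
    "(nat \<Rightarrow> operator set) \<Rightarrow> nat \<Rightarrow> (nat list \<Rightarrow> nat) \<Rightarrow> bool" where
  "representable \<O> k f \<longleftrightarrow> pointwise_operator k f \<in> \<O> k"

type_synonym triple = "(nat \<Rightarrow> nat) \<times> (nat \<Rightarrow> nat) \<times> (nat \<Rightarrow> nat)"

fun names :: "triple \<Rightarrow> real \<Rightarrow> bool" where
  "names (f, g, h) \<xi> \<longleftrightarrow>
     (\<forall>t. \<bar>(real (f t) - real (g t)) / (real (h t) + 1) - \<xi>\<bar> < 1 / (real t + 1))"

definition flatten :: "triple list \<Rightarrow> (nat \<Rightarrow> nat) list" where
  "flatten ts = concat (map (\<lambda>(f, g, h). [f, g, h]) ts)"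

text \<open>
  A function \<open>\<theta> : D \<rightarrow> \<real>\<close> with \<open>D \<subseteq> \<real>\<^sup>N\<close> is given by \<open>N\<close>, \<open>D\<close> and a total
  function whose values outside \<open>D\<close> play no role.
\<close>

definition conditionally_computable ::
    "(nat \<Rightarrow> operator set) \<Rightarrow> nat \<Rightarrow> real list set \<Rightarrow> (real list \<Rightarrow> real) \<Rightarrow> bool" where
  "conditionally_computable \<O> N D \<theta> \<longleftrightarrow>
     (\<exists>E\<in>\<O> (3 * N). \<exists>F\<in>\<O> (3 * N + 1). \<exists>G\<in>\<O> (3 * N + 1). \<exists>H\<in>\<O> (3 * N + 1).
        \<forall>\<xi>\<in>D. \<forall>ts. list_all2 names ts \<xi> \<longrightarrow>
          (\<exists>s. E (flatten ts) s = 0) \<and>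
          (\<forall>s. E (flatten ts) s = 0 \<longrightarrow>
             names (F (flatten ts @ [const_fun s]),
                    G (flatten ts @ [const_fun s]),
                    H (flatten ts @ [const_fun s])) (\<theta> \<xi>)))"

end

theory Submission imports Defs begin

text \<open>
  A witness for the composite is a single number coding witnesses for \<open>\<theta>\<^sub>1, \<dots>, \<theta>\<^sub>K\<close> and one
  for \<open>\<theta>\<^sub>0\<close>. Iterating \<open>L\<close> and \<open>R\<close> decodes it, and iterating \<open>C\<close> merges the \<open>K + 1\<close> zero tests
  into one. The test for \<open>\<theta>\<^sub>0\<close> is run on names that themselves depend on the number being tested,
  so the merged test is first built with an extra function argument in place of that number;
  closure condition (4) then replaces this argument by the constant function with the tested value.
\<close>

text \<open>Members of \<open>\<O> k\<close> are extensional. Ignoring values outside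
  \<open>tuples k\<close> lets operators be written as plain lambda terms, with no
  \<open>restrict\<close> at each composition.\<close>

definition class_mem :: "(nat \<Rightarrow> operator set) \<Rightarrow> nat \<Rightarrow> operator \<Rightarrow> bool" where
  "class_mem \<O> k F \<longleftrightarrow> restrict F (tuples k) \<in> \<O> k"

section \<open>Closure properties of an appropriate class\<close>

lemma class_mem_cong:
  assumes "class_mem \<O> k F" and "\<And>fs. length fs = k \<Longrightarrow> F fs = G fs"
  shows "class_mem \<O> k G"
proof -
  have "restrict F (tuples k) = restrict G (tuples k)"
    using assms(2) by (auto simp: restrict_def)
  then show ?thesis using assms(1) by (simp add: class_mem_def)
qed

lemma class_mem_proj:
  assumes "appropriate \<O>" and "i < k"
  shows "class_mem \<O> k (\<lambda>fs. fs ! i)"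
  using assms unfolding appropriate_def class_mem_def by blast

lemma class_mem_subst:
  assumes "appropriate \<O>" and F: "class_mem \<O> k F"
    and len: "length Gs = k" and Gs: "\<And>G. G \<in> set Gs \<Longrightarrow> class_mem \<O> l G"
  shows "class_mem \<O> l (\<lambda>gs. F (map (\<lambda>G. G gs) Gs))"
proof -
  let ?F = "restrict F (tuples k)"
  let ?Gs = "map (\<lambda>G. restrict G (tuples l)) Gs"
  have "set ?Gs \<subseteq> \<O> l" using Gs by (auto simp: class_mem_def)
  moreover have "?Gs \<in> tuples k" using len by simp
  moreover have "?F \<in> \<O> k" using F by (simp add: class_mem_def)
  moreover have "\<forall>k l. \<forall>F\<in>\<O> k. \<forall>Gs\<in>tuples k. set Gs \<subseteq> \<O> l \<longrightarrow>
        (\<lambda>gs\<in>tuples l. F (map (\<lambda>G. G gs) Gs)) \<in> \<O> l"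
    using assms(1) unfolding appropriate_def by blast
  ultimately have "(\<lambda>gs\<in>tuples l. ?F (map (\<lambda>G. G gs) ?Gs)) \<in> \<O> l" by blast
  then have "class_mem \<O> l (\<lambda>gs. ?F (map (\<lambda>G. G gs) ?Gs))" by (simp add: class_mem_def)
  then show ?thesis by (rule class_mem_cong) (simp add: len comp_def)
qed

text \<open>Substitutes \<open>F\<close> and \<open>G\<close> into the binary operator of closure
  condition (2). This is how a zero test is evaluated at a decoded witness.\<close>

lemma class_mem_comp:
  assumes "appropriate \<O>" and "class_mem \<O> k F" and "class_mem \<O> k G"
  shows "class_mem \<O> k (\<lambda>fs n. F fs (G fs n))"
proof -
  have "class_mem \<O> 2 (\<lambda>fs n. (fs ! 0) ((fs ! 1) n))"
    using assms(1) unfolding appropriate_def class_mem_def by blast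
  from class_mem_subst[OF assms(1) this, of "[F, G]" k] show ?thesis
    using assms(2,3) by auto
qed

lemma class_mem_diag:
  assumes "appropriate \<O>" and "class_mem \<O> (k + 1) F"
  shows "class_mem \<O> k (\<lambda>fs n. F (fs @ [const_fun n]) n)"
proof -
  have "\<forall>k. \<forall>F\<in>\<O> (k + 1). (\<lambda>fs\<in>tuples k. \<lambda>n. F (fs @ [const_fun n]) n) \<in> \<O> k"
    using assms(1) unfolding appropriate_def by blast
  then have "class_mem \<O> k (\<lambda>fs n. restrict F (tuples (k + 1)) (fs @ [const_fun n]) n)"
    using assms(2) unfolding class_mem_def by blast
  then show ?thesis by (rule class_mem_cong) simp
qed

lemma class_mem_pointwise1:
  assumes "appropriate \<O>" and "representable \<O> 1 (\<lambda>xs. p (xs ! 0))" and "class_mem \<O> k G"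
  shows "class_mem \<O> k (\<lambda>gs n. p (G gs n))"
proof -
  have "class_mem \<O> 1 (\<lambda>fs n. p (map (\<lambda>g. g n) fs ! 0))"
    using assms(2) by (simp add: representable_def pointwise_operator_def class_mem_def)
  from class_mem_subst[OF assms(1) this, of "[G]" k] show ?thesis
    using assms(3) by simp
qed

lemma class_mem_pointwise2:
  assumes "appropriate \<O>" and "representable \<O> 2 (\<lambda>xs. c (xs ! 0) (xs ! 1))"
    and "class_mem \<O> k F" and "class_mem \<O> k G"
  shows "class_mem \<O> k (\<lambda>gs n. c (F gs n) (G gs n))"
proof -
  have "class_mem \<O> 2 (\<lambda>fs n. c (map (\<lambda>g. g n) fs ! 0) (map (\<lambda>g. g n) fs ! 1))"
    using assms(2) by (simp add: representable_def pointwise_operator_def class_mem_def)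
  from class_mem_subst[OF assms(1) this, of "[F, G]" k] show ?thesis
    using assms(3,4) by auto
qed

section \<open>Decoding of tuples and merging of zero tests\<close>

lemma representable1_iff:
  "representable \<O> 1 (\<lambda>xs. p (xs ! 0)) \<longleftrightarrow> class_mem \<O> 1 (\<lambda>fs n. p ((fs ! 0) n))"
proof -
  have "pointwise_operator 1 (\<lambda>xs. p (xs ! 0)) = restrict (\<lambda>fs n. p ((fs ! 0) n)) (tuples 1)"
    by (auto simp: pointwise_operator_def restrict_def fun_eq_iff)
  then show ?thesis by (simp add: representable_def class_mem_def)
qed

text \<open>By induction on \<open>m\<close>: \<open>R\<close> yields the last entry, and
  \<open>L\<close> yields a code of the earlier ones, to which the previous decoding functions
  apply. Surjectivity of the pairing provides a code for every tuple.\<close>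

lemma representable_tuple_decoding:
  assumes O: "appropriate \<O>"
    and L: "representable \<O> 1 (\<lambda>xs. L (xs ! 0))" and R: "representable \<O> 1 (\<lambda>xs. R (xs ! 0))"
    and surj: "{(L s, R s) | s. True} = UNIV"
  shows "\<exists>P. (\<forall>i\<le>(m::nat). representable \<O> 1 (\<lambda>xs. P i (xs ! 0))) \<and> (\<forall>a. \<exists>s. \<forall>i\<le>m. P i s = a i)"
proof (induction m)
  case 0
  have "representable \<O> 1 (\<lambda>xs. id (xs ! 0))"
    unfolding representable1_iff using class_mem_proj[OF O, of 0 1] by simp
  then show ?case by (intro exI[of _ "\<lambda>_. id"]) simp
next
  case (Suc m)
  then obtain P where P: "\<And>i. i \<le> m \<Longrightarrow> representable \<O> 1 (\<lambda>xs. P i (xs ! 0))"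
    and ex: "\<And>a. \<exists>s. \<forall>i\<le>m. P i s = a i" by blast
  define Q where "Q i = (if i \<le> m then \<lambda>s. P i (L s) else R)" for i
  have "representable \<O> 1 (\<lambda>xs. Q i (xs ! 0))" for i
  proof (cases "i \<le> m")
    case True
    have "class_mem \<O> 1 (\<lambda>fs n. P i (L ((fs ! 0) n)))"
      by (rule class_mem_pointwise1[OF O P[OF True] iffD1[OF representable1_iff L]])
    then have "representable \<O> 1 (\<lambda>xs. P i (L (xs ! 0)))"
      by (rule iffD2[OF representable1_iff[of \<O> "\<lambda>s. P i (L s)"]])
    then show ?thesis using True by (simp add: Q_def)
  next
    case False
    then show ?thesis using R by (simp add: Q_def)
  qed
  moreover have "\<exists>s. \<forall>i\<le>Suc m. Q i s = a i" for a
  proof -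
    obtain t where t: "\<forall>i\<le>m. P i t = a i" using ex by blast
    have "(t, a (Suc m)) \<in> {(L s, R s) | s. True}" using surj by simp
    then obtain s where "L s = t" "R s = a (Suc m)" by auto
    then have "\<forall>i\<le>Suc m. Q i s = a i" using t by (simp add: Q_def le_Suc_eq)
    then show ?thesis by (rule exI)
  qed
  ultimately show ?case by blast
qed

text \<open>Since \<open>C\<close> vanishes only at the pair of zeros, it acts as a conjunction of
  tests. The equivalence holds for lists of every length, because the merged test is built as an
  unrestricted function.\<close>

lemma class_mem_merge_tests:
  assumes O: "appropriate \<O>" and C: "representable \<O> 2 (\<lambda>xs. C (xs ! 0) (xs ! 1))"
    and zero: "{(u, v). C u v = 0} = {(0, 0)}"
    and T: "\<And>i. i \<le> (m::nat) \<Longrightarrow> class_mem \<O> k (T i)"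
  shows "\<exists>E. class_mem \<O> k E \<and> (\<forall>fs n. E fs n = 0 \<longleftrightarrow> (\<forall>i\<le>m. T i fs n = 0))"
  using T
proof (induction m)
  case 0
  then show ?case by (intro exI[of _ "T 0"]) simp
next
  case (Suc m)
  then obtain E where E: "class_mem \<O> k E" "\<And>fs n. E fs n = 0 \<longleftrightarrow> (\<forall>i\<le>m. T i fs n = 0)"
    by (metis le_SucI)
  have C0: "C u v = 0 \<longleftrightarrow> u = 0 \<and> v = 0" for u v
    using zero by (auto simp: set_eq_iff)
  have "class_mem \<O> k (\<lambda>fs n. C (E fs n) (T (Suc m) fs n))"
    using class_mem_pointwise2[OF O C E(1) Suc.prems] by simp
  moreover have "C (E fs n) (T (Suc m) fs n) = 0 \<longleftrightarrow> (\<forall>i\<le>Suc m. T i fs n = 0)" for fs n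
    by (auto simp: C0 E(2) le_Suc_eq)
  ultimately show ?case by blast
qed

section \<open>Flattened lists of triples and operators with one extra argument\<close>

lemma flatten_map:
  "flatten (map (\<lambda>i. (f i, g i, h i)) xs) = concat (map (\<lambda>i. [f i, g i, h i]) xs)"
  by (simp add: flatten_def comp_def)

lemma length_concat_map_triples: "length (concat (map (\<lambda>i. [f i, g i, h i]) xs)) = 3 * length xs"
  by (induction xs) auto

lemma length_flatten: "length (flatten ts) = 3 * length ts"
  by (induction ts) (auto simp: flatten_def)

text \<open>Substitution of the first \<open>k\<close> projections followed by \<open>G\<close>. It
  serves to replace a code in the last argument by the witness decoded from it.\<close>

lemma class_mem_app_last:
  assumes O: "appropriate \<O>" and F: "class_mem \<O> (k + 1) F" and G: "class_mem \<O> (k + 1) G"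
  shows "class_mem \<O> (k + 1) (\<lambda>gs. F (take k gs @ [G gs]))"
proof -
  let ?Gs = "map (\<lambda>j gs. gs ! j) [0..<k] @ [G]"
  have "class_mem \<O> (k + 1) (\<lambda>gs. F (map (\<lambda>G. G gs) ?Gs))"
    by (rule class_mem_subst[OF O F]) (use G in \<open>auto intro!: class_mem_proj[OF O]\<close>)
  then show ?thesis
  proof (rule class_mem_cong)
    fix gs :: "(nat \<Rightarrow> nat) list"
    assume "length gs = k + 1"
    then have "map (\<lambda>G. G gs) ?Gs = take k gs @ [G gs]"
      by (auto intro!: nth_equalityI simp: nth_append)
    then show "F (map (\<lambda>G. G gs) ?Gs) = F (take k gs @ [G gs])" by simp
  qed
qed

lemma class_mem_take:
  assumes O: "appropriate \<O>" and F: "class_mem \<O> k F"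
  shows "class_mem \<O> (k + 1) (\<lambda>gs. F (take k gs))"
proof -
  let ?Gs = "map (\<lambda>j gs. gs ! j) [0..<k]"
  have "class_mem \<O> (k + 1) (\<lambda>gs. F (map (\<lambda>G. G gs) ?Gs))"
    by (rule class_mem_subst[OF O F]) (auto intro!: class_mem_proj[OF O])
  then show ?thesis
  proof (rule class_mem_cong)
    fix gs :: "(nat \<Rightarrow> nat) list"
    assume "length gs = k + 1"
    then have "map (\<lambda>G. G gs) ?Gs = take k gs"
      by (auto intro!: nth_equalityI)
    then show "F (map (\<lambda>G. G gs) ?Gs) = F (take k gs)" by simp
  qed
qed

section \<open>Conditional computability in terms of unrestricted functions\<close>

lemma class_mem_of_mem:
  assumes "appropriate \<O>" and "F \<in> \<O> k"
  shows "class_mem \<O> k F"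
proof -
  have "F \<in> operators k" using assms unfolding appropriate_def by blast
  then have "restrict F (tuples k) = F"
    unfolding operators_def by (rule PiE_restrict)
  then show ?thesis using assms(2) by (simp add: class_mem_def)
qed

text \<open>Separates the requirement on the values of the four operators from their membership in
  the class.\<close>

definition computes_conditionally ::
    "real list set \<Rightarrow> (real list \<Rightarrow> real) \<Rightarrow> operator \<Rightarrow> operator \<Rightarrow> operator \<Rightarrow> operator \<Rightarrow> bool"
  where
  "computes_conditionally D \<theta> E F G H \<longleftrightarrow>
     (\<forall>\<xi>\<in>D. \<forall>ts. list_all2 names ts \<xi> \<longrightarrow>
        (\<exists>s. E (flatten ts) s = 0) \<and>
        (\<forall>s. E (flatten ts) s = 0 \<longrightarrow>
           names (F (flatten ts @ [const_fun s]),
                  G (flatten ts @ [const_fun s]),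
                  H (flatten ts @ [const_fun s])) (\<theta> \<xi>)))"

text \<open>Because \<open>D\<close> lies in \<open>tuples N\<close>, every list of names involved
  flattens to length \<open>3 * N\<close>. Restricting the operators therefore changes none of the
  values that matter.\<close>

lemma conditionally_computable_iff:
  assumes O: "appropriate \<O>" and D: "D \<subseteq> tuples N"
  shows "conditionally_computable \<O> N D \<theta> \<longleftrightarrow>
    (\<exists>E F G H. class_mem \<O> (3 * N) E \<and> class_mem \<O> (3 * N + 1) F \<and>
       class_mem \<O> (3 * N + 1) G \<and> class_mem \<O> (3 * N + 1) H \<and>
       computes_conditionally D \<theta> E F G H)" (is "?lhs \<longleftrightarrow> ?rhs")
proof
  assume ?lhs
  then show ?rhs
    unfolding conditionally_computable_def computes_conditionally_def
    using class_mem_of_mem[OF O] by meson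
next
  assume ?rhs
  then obtain E F G H where mem: "class_mem \<O> (3 * N) E" "class_mem \<O> (3 * N + 1) F"
      "class_mem \<O> (3 * N + 1) G" "class_mem \<O> (3 * N + 1) H"
    and comp: "computes_conditionally D \<theta> E F G H" by blast
  let ?E = "restrict E (tuples (3 * N))"
  let ?r = "\<lambda>F. restrict F (tuples (3 * N + 1))"
  have len: "length (flatten ts) = 3 * N" if "\<xi> \<in> D" "list_all2 names ts \<xi>" for \<xi> ts
    using that D by (auto simp: length_flatten dest: list_all2_lengthD)
  have "computes_conditionally D \<theta> ?E (?r F) (?r G) (?r H)"
    unfolding computes_conditionally_def
  proof (intro ballI allI impI)
    fix \<xi> ts assume *: "\<xi> \<in> D" "list_all2 names ts \<xi>"
    show "(\<exists>s. ?E (flatten ts) s = 0) \<and>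
        (\<forall>s. ?E (flatten ts) s = 0 \<longrightarrow>
           names (?r F (flatten ts @ [const_fun s]),
                  ?r G (flatten ts @ [const_fun s]),
                  ?r H (flatten ts @ [const_fun s])) (\<theta> \<xi>))"
      using comp * len[OF *] unfolding computes_conditionally_def by (simp del: names.simps)
  qed
  then show ?lhs
    using mem unfolding conditionally_computable_def computes_conditionally_def class_mem_def
    by blast
qed

section \<open>Substitution of real functions\<close>

theorem theorem1:
  fixes \<O> :: "nat \<Rightarrow> operator set"
    and C :: "nat \<Rightarrow> nat \<Rightarrow> nat" and L R :: "nat \<Rightarrow> nat"
    and K N :: nat
    and D\<^sub>0 :: "real list set" and \<theta>\<^sub>0 :: "real list \<Rightarrow> real"
    and D :: "nat \<Rightarrow> real list set" and \<theta> :: "nat \<Rightarrow> real list \<Rightarrow> real"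
  assumes "appropriate \<O>"
    and "representable \<O> 2 (\<lambda>xs. C (xs ! 0) (xs ! 1))"
    and "representable \<O> 1 (\<lambda>xs. L (xs ! 0))"
    and "representable \<O> 1 (\<lambda>xs. R (xs ! 0))"
    and "{(u, v). C u v = 0} = {(0, 0)}"
    and "{(L s, R s) | s. True} = UNIV"
    and "D\<^sub>0 \<subseteq> tuples K"
    and "conditionally_computable \<O> K D\<^sub>0 \<theta>\<^sub>0"
    and "\<And>i. i \<in> {1..K} \<Longrightarrow> D i \<subseteq> tuples N"
    and "\<And>i. i \<in> {1..K} \<Longrightarrow> conditionally_computable \<O> N (D i) (\<theta> i)"
  shows "conditionally_computable \<O> N
           {\<xi> \<in> tuples N. (\<forall>i\<in>{1..K}. \<xi> \<in> D i) \<and> map (\<lambda>i. \<theta> i \<xi>) [1..<K + 1] \<in> D\<^sub>0}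
           (\<lambda>\<xi>. \<theta>\<^sub>0 (map (\<lambda>i. \<theta> i \<xi>) [1..<K + 1]))"
proof -
  note O = assms(1)
  define k where "k = 3 * N"
  obtain E\<^sub>0 F\<^sub>0 G\<^sub>0 H\<^sub>0 where mem0: "class_mem \<O> (3 * K) E\<^sub>0" "class_mem \<O> (3 * K + 1) F\<^sub>0"
      "class_mem \<O> (3 * K + 1) G\<^sub>0" "class_mem \<O> (3 * K + 1) H\<^sub>0"
    and comp0: "computes_conditionally D\<^sub>0 \<theta>\<^sub>0 E\<^sub>0 F\<^sub>0 G\<^sub>0 H\<^sub>0"
    using assms(8) unfolding conditionally_computable_iff[OF O assms(7)] by blast
  have "\<forall>i\<in>{1..K}. \<exists>E F G H. class_mem \<O> k E \<and> class_mem \<O> (k + 1) F \<and>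
       class_mem \<O> (k + 1) G \<and> class_mem \<O> (k + 1) H \<and>
       computes_conditionally (D i) (\<theta> i) E F G H"
    using assms(10) conditionally_computable_iff[OF O assms(9)] unfolding k_def by blast
  then obtain E F G H where mem: "\<And>i. i \<in> {1..K} \<Longrightarrow> class_mem \<O> k (E i)"
      "\<And>i. i \<in> {1..K} \<Longrightarrow> class_mem \<O> (k + 1) (F i)"
      "\<And>i. i \<in> {1..K} \<Longrightarrow> class_mem \<O> (k + 1) (G i)"
      "\<And>i. i \<in> {1..K} \<Longrightarrow> class_mem \<O> (k + 1) (H i)"
    and comp: "\<And>i. i \<in> {1..K} \<Longrightarrow> computes_conditionally (D i) (\<theta> i) (E i) (F i) (G i) (H i)"
    by metis
  obtain P where P: "\<And>i. i \<le> K \<Longrightarrow> representable \<O> 1 (\<lambda>xs. P i (xs ! 0))"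
    and P_surj: "\<And>a. \<exists>s. \<forall>i\<le>K. P i s = a i"
    using representable_tuple_decoding[OF O assms(3,4,6), of K] by blast
  \<comment> \<open>Position \<open>k\<close> is the extra argument, meant to hold the constant
    function of a candidate code. Index \<open>0\<close> is reserved for the witness of
    \<open>\<theta>\<^sub>0\<close>, and indices from \<open>1\<close> to \<open>K\<close> for those
    of the inner functions.\<close>
  define wit where "wit i gs = (\<lambda>n. P i ((gs ! k) n))" for i :: nat and gs :: "(nat \<Rightarrow> nat) list"
  have wit: "class_mem \<O> (k + 1) (wit i)" if "i \<le> K" for i
    unfolding wit_def by (rule class_mem_pointwise1[OF O P[OF that] class_mem_proj[OF O]]) simp
  define inner where "inner A i gs = A i (take k gs @ [wit i gs])"
    for A :: "nat \<Rightarrow> operator" and i gs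
  have inner: "class_mem \<O> (k + 1) (inner A i)"
    if "class_mem \<O> (k + 1) (A i)" "i \<in> {1..K}" for A i
    unfolding inner_def using class_mem_app_last[OF O that(1) wit] that(2) by simp
  define Gs where "Gs = concat (map (\<lambda>i. [inner F i, inner G i, inner H i]) [1..<K + 1])"
  have len_Gs: "length Gs = 3 * K" by (simp only: Gs_def length_concat_map_triples) simp
  have Gs: "class_mem \<O> (k + 1) A" if "A \<in> set Gs" for A
  proof -
    have "\<exists>i\<in>{1..K}. A \<in> {inner F i, inner G i, inner H i}"
      using that unfolding Gs_def by (fastforce simp del: upt_Suc)
    then show ?thesis using inner mem by blast
  qed
  \<comment> \<open>These are the triples intended to name the values of the inner functions;
    \<open>Gs\<close> lists their components as separate operators, as closure condition (3)
    demands.\<close>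
  define W where "W gs = map (\<lambda>i. (inner F i gs, inner G i gs, inner H i gs)) [1..<K + 1]" for gs
  have W: "map (\<lambda>A. A gs) Gs = flatten (W gs)" for gs
    unfolding W_def Gs_def flatten_map by (simp add: map_concat comp_def del: upt_Suc)
  define outer where "outer A gs = A (flatten (W gs) @ [wit 0 gs])" for A :: operator and gs
  have outer: "class_mem \<O> (k + 1) (outer A)" if "class_mem \<O> (3 * K + 1) A" for A
  proof -
    have "class_mem \<O> (k + 1) (\<lambda>gs. A (map (\<lambda>A. A gs) (Gs @ [wit 0])))"
      by (rule class_mem_subst[OF O that]) (use len_Gs Gs wit[of 0] in \<open>auto simp del: add_Suc_right\<close>)
    then show ?thesis by (simp add: W outer_def[abs_def])
  qed
  \<comment> \<open>\<open>T i\<close> asks whether the decoded number with index \<open>i\<close>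
    is a valid witness. Only the test with index \<open>0\<close> runs on the computed names
    \<open>W gs\<close>; the others use the original ones.\<close>
  define T where "T i gs = (\<lambda>n. (if i = 0 then E\<^sub>0 (flatten (W gs)) else E i (take k gs)) (wit i gs n))"
    for i gs
  have T: "class_mem \<O> (k + 1) (T i)" if "i \<le> K" for i
  proof (cases "i = 0")
    case True
    have "class_mem \<O> (k + 1) (\<lambda>gs. E\<^sub>0 (map (\<lambda>A. A gs) Gs))"
      by (rule class_mem_subst[OF O mem0(1) len_Gs Gs])
    then show ?thesis
      using class_mem_comp[OF O _ wit[OF that]] True by (simp add: W T_def[abs_def])
  next
    case False
    then have "class_mem \<O> (k + 1) (\<lambda>gs. E i (take k gs))"
      using class_mem_take[OF O mem(1)] that by simp
    then show ?thesis
      using class_mem_comp[OF O _ wit[OF that]] False by (simp add: T_def[abs_def])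
  qed
  obtain T' where T': "class_mem \<O> (k + 1) T'" "\<And>gs n. T' gs n = 0 \<longleftrightarrow> (\<forall>i\<le>K. T i gs n = 0)"
    using class_mem_merge_tests[OF O assms(2,5), of K "k + 1" T] T by blast
  define E' where "E' fs = (\<lambda>n. T' (fs @ [const_fun n]) n)" for fs
  have E': "class_mem \<O> k E'" unfolding E'_def using class_mem_diag[OF O T'(1)] .
  let ?D = "{\<xi> \<in> tuples N. (\<forall>i\<in>{1..K}. \<xi> \<in> D i) \<and> map (\<lambda>i. \<theta> i \<xi>) [1..<K + 1] \<in> D\<^sub>0}"
  let ?\<theta> = "\<lambda>\<xi>. \<theta>\<^sub>0 (map (\<lambda>i. \<theta> i \<xi>) [1..<K + 1])"
  have "computes_conditionally ?D ?\<theta> E' (outer F\<^sub>0) (outer G\<^sub>0) (outer H\<^sub>0)"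
    unfolding computes_conditionally_def
  proof (intro ballI allI impI)
    fix \<xi> ts assume \<xi>: "\<xi> \<in> ?D" and ts: "list_all2 names ts \<xi>"
    define fs where "fs = flatten ts"
    \<comment> \<open>The names computed from arbitrary witnesses \<open>a\<close>, without
      reference to a code: a witness for \<open>\<theta>\<^sub>0\<close> has to be found before a
      code exists.\<close>
    define V where "V a = map (\<lambda>i. (F i (fs @ [const_fun (a i)]), G i (fs @ [const_fun (a i)]),
        H i (fs @ [const_fun (a i)]))) [1..<K + 1]" for a
    have len: "length fs = k"
      using \<xi> list_all2_lengthD[OF ts] by (simp add: fs_def k_def length_flatten)
    \<comment> \<open>Decoding a constant function pointwise gives a constant function again, which
      is the form of last argument that \<open>computes_conditionally\<close> speaks about.\<close>
    have wit_const: "wit i (fs @ [const_fun s]) = const_fun (P i s)" for i s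
      by (simp add: wit_def len nth_append const_fun_def)
    have W_V: "W (fs @ [const_fun s]) = V (\<lambda>i. P i s)" for s
      by (simp add: W_def V_def inner_def wit_const len del: upt_Suc)
    have E'_iff: "E' fs s = 0 \<longleftrightarrow>
        E\<^sub>0 (flatten (V (\<lambda>i. P i s))) (P 0 s) = 0 \<and> (\<forall>i\<in>{1..K}. E i fs (P i s) = 0)" for s
      unfolding E'_def T'(2) T_def W_V wit_const
      by (auto simp: len const_fun_def)
    have V: "list_all2 names (V a) (map (\<lambda>i. \<theta> i \<xi>) [1..<K + 1])"
      if "\<forall>i\<in>{1..K}. E i fs (a i) = 0" for a
      unfolding V_def list_all2_map1 list_all2_map2
    proof (rule list.rel_refl_strong)
      fix i assume "i \<in> set [1..<K + 1]"
      then have i: "i \<in> {1..K}" by auto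
      show "names (F i (fs @ [const_fun (a i)]), G i (fs @ [const_fun (a i)]),
          H i (fs @ [const_fun (a i)])) (\<theta> i \<xi>)"
        using comp[OF i] that i \<xi> ts unfolding computes_conditionally_def fs_def by blast
    qed
    have "\<forall>i\<in>{1..K}. \<exists>s. E i fs s = 0"
      using comp \<xi> ts unfolding computes_conditionally_def fs_def by blast
    \<comment> \<open>The order of choices matters: \<open>a\<close> fixes the names
      \<open>V a\<close>, these provide a zero \<open>b\<close> of the outer test, and only then are
      all the witnesses coded by \<open>s\<close>.\<close>
    then obtain a where a: "\<forall>i\<in>{1..K}. E i fs (a i) = 0" by metis
    then obtain b where b: "E\<^sub>0 (flatten (V a)) b = 0"
      using V comp0 \<xi> unfolding computes_conditionally_def by blast
    obtain s where s: "\<forall>i\<le>K. P i s = (if i = 0 then b else a i)"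
      using P_surj[of "\<lambda>i. if i = 0 then b else a i"] by blast
    \<comment> \<open>\<open>V\<close> reads only the indices from \<open>1\<close> to
      \<open>K\<close>, so the entry \<open>b\<close> at index \<open>0\<close> leaves the names
      unchanged.\<close>
    have "V (\<lambda>i. P i s) = V a" using s by (auto simp: V_def simp del: upt_Suc)
    then have "E' fs s = 0" using s a b by (simp add: E'_iff)
    \<comment> \<open>Here \<open>s\<close> is an arbitrary zero of \<open>E'\<close>, not the code
      just built. Its decoded entries pass every test, so the inner names are correct and the outer
      operators may be applied to them.\<close>
    moreover have "names (outer F\<^sub>0 (fs @ [const_fun s]), outer G\<^sub>0 (fs @ [const_fun s]),
        outer H\<^sub>0 (fs @ [const_fun s])) (?\<theta> \<xi>)" if "E' fs s = 0" for s
      using that V[of "\<lambda>i. P i s"] comp0 \<xi>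
      unfolding outer_def W_V wit_const E'_iff computes_conditionally_def by blast
    ultimately show "(\<exists>s. E' (flatten ts) s = 0) \<and>
        (\<forall>s. E' (flatten ts) s = 0 \<longrightarrow>
           names (outer F\<^sub>0 (flatten ts @ [const_fun s]),
                  outer G\<^sub>0 (flatten ts @ [const_fun s]),
                  outer H\<^sub>0 (flatten ts @ [const_fun s])) (?\<theta> \<xi>))"
      unfolding fs_def by blast
  qed
  then have "\<exists>E F G H. class_mem \<O> (3 * N) E \<and> class_mem \<O> (3 * N + 1) F \<and>
       class_mem \<O> (3 * N + 1) G \<and> class_mem \<O> (3 * N + 1) H \<and>
       computes_conditionally ?D ?\<theta> E F G H"
    using E' outer[OF mem0(2)] outer[OF mem0(3)] outer[OF mem0(4)]
    unfolding k_def by (intro exI conjI)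
  \<comment> \<open>The side condition of the rewriting is that the domain lies in
    \<open>tuples N\<close>, which is part of its description.\<close>
  then show ?thesis by (subst conditionally_computable_iff[OF O]) auto
qed

end
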